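(* Let $\mathcal{X}\subset\mathbb{R}^d$ be compact and let $X$ be the Markov chain on $\mathcal{X}$ given by $X_{n+1}=f_{n+1}(X_n)$, where $f_1,f_2,\dots$ are iid copies of an almost surely locally Lipschitz random mapping $f:\mathcal{X}\to\mathcal{X}$. Let $U:\mathcal{X}\to\mathbb{R}_+$ with $\inf U>0$. Suppose $\|\mathbb{E}Df\|_\infty=\sup_{x\in\mathcal{X}}\mathbb{E}\,Df(x)$ is finite and that $$V_*(x)=\mathbb{E}_x\Big[\sum_{k=0}^\infty U(X_k)\prod_{l=1}^{k}Df_l(X_{l-1})\Big]$$ is finite and continuous on $\mathcal{X}$. Then for any $\epsilon>0$ there exists a neural network $\{V_\theta:\theta\in\Theta\}$ and a parameter $\theta_*\in\Theta$ such that $$\|KV_{\theta_*}-V_{\theta_*}+U\|_\infty<\epsilon.$$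
   Context: $\|\cdot\|$ is the Euclidean norm and $\|\cdot\|_\infty$ the sup norm of functions on $\mathcal{X}$. For a locally Lipschitz map $g$, $Dg(x)=\lim_{\delta\to0}\sup_{x',x''\in B_\delta(x)}\frac{\|g(x')-g(x'')\|}{\|x'-x''\|}$ with $B_\delta(x)$ the open Euclidean ball. The operator $K$ acts on functions $V$ on $\mathcal{X}$ by $KV(x)=\mathbb{E}[Df(x)V(f(x))]$. $\mathbb{E}_x$ denotes expectation given $X_0=x$; the empty product equals $1$. A neural network $\{V_\theta:\theta\in\Theta\}$ is a parametric family of real functions on $\mathcal{X}$ computed by a feedforward neural network architecture (e.g. a single hidden layer with sigmoid activation), with parameter space $\Theta$ a Euclidean space. *)

theory Defs
  imports "HOL-Probability.Probability"
begin

text \<open>Local Lipschitz constant of a map g defined on the set S, at the point x: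
  D g x = lim_{delta -> 0} sup_{x',x'' in B_delta(x) cap S, x' ~= x''} |g x' - g x''| / |x' - x''|.
  Since the inner supremum is monotone in delta, the limit equals the infimum over delta > 0.
  Computed in ennreal, then converted to real (finite for locally Lipschitz maps).\<close>
definition lip_const :: "('a::euclidean_space) set \<Rightarrow> ('a \<Rightarrow> 'b::real_normed_vector) \<Rightarrow> 'a \<Rightarrow> real" where
  "lip_const S g x = enn2real
     (INF \<delta>\<in>{0<..}. SUP p\<in>{(y, z). y \<in> ball x \<delta> \<inter> S \<and> z \<in> ball x \<delta> \<inter> S \<and> y \<noteq> z}.
        ennreal (norm (g (fst p) - g (snd p)) / dist (fst p) (snd p)))"

definition loc_lipschitz_on :: "('a::euclidean_space) set \<Rightarrow> ('a \<Rightarrow> 'b::real_normed_vector) \<Rightarrow> bool" where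
  "loc_lipschitz_on S g \<longleftrightarrow>
     (\<forall>x\<in>S. \<exists>\<delta>>0. \<exists>L. \<forall>y\<in>ball x \<delta> \<inter> S. \<forall>z\<in>ball x \<delta> \<inter> S. norm (g y - g z) \<le> L * dist y z)"

text \<open>Chain started at x driven by the iid maps f(w 0), f(w 1), ...:
  X_0 = x, X_{k+1} = f_{k+1}(X_k) with f_{k+1} = f (w k).\<close>
fun chain :: "('w \<Rightarrow> 'a \<Rightarrow> 'a) \<Rightarrow> (nat \<Rightarrow> 'w) \<Rightarrow> 'a \<Rightarrow> nat \<Rightarrow> 'a" where
  "chain f w x 0 = x"
| "chain f w x (Suc k) = f (w k) (chain f w x k)"

definition K_op :: "'w measure \<Rightarrow> ('a::euclidean_space) set \<Rightarrow> ('w \<Rightarrow> 'a \<Rightarrow> 'a) \<Rightarrow> ('a \<Rightarrow> real) \<Rightarrow> 'a \<Rightarrow> real" where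
  "K_op M S f V x = (\<integral>\<omega>. lip_const S (f \<omega>) x * V (f \<omega> x) \<partial>M)"

text \<open>V_*(x) = E_x[ sum_k U(X_k) prod_{l=1}^k Df_l(X_{l-1}) ], with iid f_1, f_2, ...
  realised on the infinite product space M^N (nonnegative integrand, ennreal-valued).\<close>
definition V_star :: "'w measure \<Rightarrow> ('a::euclidean_space) set \<Rightarrow> ('w \<Rightarrow> 'a \<Rightarrow> 'a) \<Rightarrow> ('a \<Rightarrow> real) \<Rightarrow> 'a \<Rightarrow> ennreal" where
  "V_star M S f U x = (\<integral>\<^sup>+ w. (\<Sum>k. ennreal (U (chain f w x k) *
       (\<Prod>l<k. lip_const S (f (w l)) (chain f w x l)))) \<partial>(PiM UNIV (\<lambda>_::nat. M)))"

definition sigmoid :: "real \<Rightarrow> real" where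
  "sigmoid t = 1 / (1 + exp (- t))"

text \<open>Single-hidden-layer sigmoid network with m hidden units; parameter
  theta = (a, w, b) restricted to indices < m, i.e. a point of a Euclidean space.\<close>
definition sig_net :: "nat \<Rightarrow> (nat \<Rightarrow> real) \<Rightarrow> (nat \<Rightarrow> 'a::euclidean_space) \<Rightarrow> (nat \<Rightarrow> real) \<Rightarrow> 'a \<Rightarrow> real" where
  "sig_net m a w b x = (\<Sum>j<m. a j * sigmoid (inner (w j) x + b j))"

end

theory Submission
  imports Defs
begin

text \<open>The function V* is a bounded solution of U = V* - K V*, so replacing it by a network V that is
  uniformly \<delta>-close to it changes the residual by at most \<delta> (1 + sup E Df).

  Networks are uniformly dense because exp s * sigmoid (t - s) tends to exp t, uniformly on bounded
  sets, as s tends to infinity, and sums of exponentials are dense by Stone-Weierstrass.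

  Nothing makes U measurable, so the expectation defining V* is only a lower integral. Fubini for
  measurable minorants still gives V* \<le> U + K V*. Conversely, U dominates the measurable function
  U0 = max (V* - K V*) 0, and summing K^k U0 telescopes to at least V* - lim K^n V*, where
  K^n V* tends to 0 because inf U * (\<Sum>n. K^n 1) \<le> V* is finite and V* is bounded.\<close>

section \<open>Universal approximation by sigmoid networks\<close>

inductive exp_sum :: "('a::euclidean_space \<Rightarrow> real) \<Rightarrow> bool" where
  single: "exp_sum (\<lambda>x. c * exp (inner w x))"
| add: "exp_sum g \<Longrightarrow> exp_sum h \<Longrightarrow> exp_sum (\<lambda>x. g x + h x)"

text \<open>The exponentials of \<open>w\<close> and \<open>w'\<close> multiply to the exponential
  of \<open>w + w'\<close>, so their linear span is closed under products. This makes it an algebra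
  to which Stone-Weierstrass applies.\<close>

lemma exp_sum_mult:
  assumes "exp_sum g" "exp_sum h"
  shows "exp_sum (\<lambda>x. g x * h x)"
proof -
  have single_mult: "exp_sum (\<lambda>x. c * exp (inner w x) * h x)" for c w
    using assms(2)
  proof induction
    case (single c' w')
    have "(\<lambda>x. c * exp (inner w x) * (c' * exp (inner w' x))) =
        (\<lambda>x. (c * c') * exp (inner (w + w') x))"
      by (simp add: inner_add_left exp_add mult_ac)
    then show ?case by (metis exp_sum.single)
  next
    case (add g h)
    then show ?case
      by (simp only: distrib_left exp_sum.add)
  qed
  from assms(1) show ?thesis
    by induction (simp_all only: single_mult distrib_right exp_sum.add)
qed

lemma exp_sum_continuous: "exp_sum g \<Longrightarrow> continuous_on X g"
  by (induction rule: exp_sum.induct) (auto intro!: continuous_intros)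

lemma exp_sum_dense:
  fixes h :: "'a::euclidean_space \<Rightarrow> real"
  assumes "compact X" "continuous_on X h" "0 < e"
  shows "\<exists>g. exp_sum g \<and> (\<forall>x\<in>X. \<bar>h x - g x\<bar> < e)"
proof (rule Stone_Weierstrass_HOL[OF assms(1) _ _ _ _ _ assms(2,3)])
  show "exp_sum (\<lambda>x::'a. c)" for c
    using exp_sum.single[of c 0] by simp
  show "\<exists>g. exp_sum g \<and> g x \<noteq> g y" if "x \<in> X \<and> y \<in> X \<and> x \<noteq> y" for x y :: 'a
  proof (intro exI conjI)
    \<comment> \<open>The direction \<open>x - y\<close> separates the two points, because its inner
      product with itself is nonzero.\<close>
    show "exp_sum (\<lambda>z. 1 * exp (inner (x - y) z))"
      by (rule exp_sum.single)
    have "inner (x - y) x \<noteq> inner (x - y) y"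
      using that by (metis inner_diff_right inner_eq_zero_iff right_minus_eq)
    then show "1 * exp (inner (x - y) x) \<noteq> 1 * exp (inner (x - y) y)"
      by simp
  qed
qed (auto intro: exp_sum_continuous exp_sum.add exp_sum_mult)

text \<open>Far in its left tail the sigmoid behaves like an exponential. The exact error is exp (2
  t) / (exp t + exp s), and dropping exp t from the denominator gives the bound.\<close>

lemma sigmoid_shift_approx_exp: "\<bar>exp s * sigmoid (t - s) - exp t\<bar> \<le> exp (2 * t - s)"
proof -
  have "exp s * sigmoid (t - s) - exp t = - (exp t * exp t / (exp t + exp s))"
  proof -
    have "sigmoid (t - s) = exp t / (exp t + exp s)"
      by (simp add: sigmoid_def exp_diff field_simps)
    then show ?thesis
      by (simp add: field_simps add_pos_pos add_nonneg_eq_0_iff)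
  qed
  also have "\<bar>\<dots>\<bar> = exp t * exp t / (exp t + exp s)"
    by (simp add: add_pos_pos)
  also have "\<dots> \<le> exp t * exp t / exp s"
    by (intro divide_left_mono) (auto simp: add_pos_pos)
  also have "\<dots> = exp (2 * t - s)"
    by (simp add: exp_diff exp_add[symmetric])
  finally show ?thesis .
qed

text \<open>Two hidden layers are placed side by side, the units of the second being numbered from
  \<open>m\<close> on.\<close>

lemma sig_net_add:
  "\<exists>a'' w'' b''. \<forall>x. sig_net (m + m') a'' w'' b'' x = sig_net m a w b x + sig_net m' a' w' b' x"
proof (intro exI allI)
  fix x
  let ?g = "\<lambda>u u' j. if j < m then u j else u' (j - m)"
  \<comment> \<open>With the parameters fixed, the size \<open>n\<close> of the second network is
    left free, so that induction appends one unit at a time.\<close>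
  have "sig_net (m + n) (?g a a') (?g w w') (?g b b') x = sig_net m a w b x + sig_net n a' w' b' x" for n
    by (induction n) (simp_all add: sig_net_def)
  then show "sig_net (m + m') (?g a a') (?g w w') (?g b b') x = sig_net m a w b x + sig_net m' a' w' b' x" .
qed

lemma sig_net_approx_exp_sum:
  assumes "exp_sum g" "bounded X" "0 < e"
  shows "\<exists>m a w b. \<forall>x\<in>X. \<bar>g x - sig_net m a w b x\<bar> < e"
  using assms(1,3)
proof (induction arbitrary: e)
  case (single c w)
  obtain B where B: "\<And>x. x \<in> X \<Longrightarrow> norm x \<le> B"
    using assms(2) by (auto simp: bounded_iff)
  define T where "T = norm w * B"
  have T: "inner w x \<le> T" if "x \<in> X" for x
    using norm_cauchy_schwarz[of w x] mult_left_mono[OF B[OF that], of "norm w"] by (simp add: T_def)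
  \<comment> \<open>Solves exp (2 T - s) = e / (\<bar>c\<bar> + 1). The summand 1 makes the final
    inequality strict and covers c = 0. A single hidden unit with bias - s and outer coefficient c
    exp s is then enough.\<close>
  define s where "s = 2 * T - ln (e / (\<bar>c\<bar> + 1))"
  have "\<bar>c * exp (inner w x) - sig_net 1 (\<lambda>_. c * exp s) (\<lambda>_. w) (\<lambda>_. - s) x\<bar> < e" if "x \<in> X" for x
  proof -
    have "\<bar>c * exp (inner w x) - sig_net 1 (\<lambda>_. c * exp s) (\<lambda>_. w) (\<lambda>_. - s) x\<bar>
        = \<bar>c\<bar> * \<bar>exp s * sigmoid (inner w x - s) - exp (inner w x)\<bar>"
      by (simp add: sig_net_def abs_mult[symmetric] right_diff_distrib mult.assoc abs_minus_commute)
    also have "\<dots> \<le> \<bar>c\<bar> * exp (2 * inner w x - s)"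
      by (intro mult_left_mono sigmoid_shift_approx_exp) auto
    also have "\<dots> \<le> \<bar>c\<bar> * exp (2 * T - s)"
      using T[OF that] by (intro mult_left_mono) auto
    also have "\<dots> = \<bar>c\<bar> * (e / (\<bar>c\<bar> + 1))"
      using single by (simp add: s_def)
    also have "\<dots> < e"
      using single by (simp add: field_simps)
    finally show ?thesis .
  qed
  then show ?case by blast
next
  case (add g h)
  obtain m a w b where 1: "\<forall>x\<in>X. \<bar>g x - sig_net m a w b x\<bar> < e / 2"
    using add.IH(1)[of "e / 2"] add.prems by auto
  obtain m' a' w' b' where 2: "\<forall>x\<in>X. \<bar>h x - sig_net m' a' w' b' x\<bar> < e / 2"
    using add.IH(2)[of "e / 2"] add.prems by auto
  obtain a'' w'' b'' where 3:
    "\<forall>x. sig_net (m + m') a'' w'' b'' x = sig_net m a w b x + sig_net m' a' w' b' x"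
    using sig_net_add by blast
  have "\<bar>g x + h x - sig_net (m + m') a'' w'' b'' x\<bar> < e" if "x \<in> X" for x
    using 1 2 that unfolding 3[rule_format] by (smt (verit) field_sum_of_halves)
  then show ?case by blast
qed

theorem sig_net_universal_approximation:
  fixes h :: "'a::euclidean_space \<Rightarrow> real"
  assumes "compact X" "continuous_on X h" "0 < e"
  shows "\<exists>m a w b. \<forall>x\<in>X. \<bar>h x - sig_net m a w b x\<bar> < e"
proof -
  obtain g where g: "exp_sum g" "\<forall>x\<in>X. \<bar>h x - g x\<bar> < e / 2"
    using exp_sum_dense[OF assms(1,2), of "e / 2"] assms(3) by auto
  obtain m a w b where n: "\<forall>x\<in>X. \<bar>g x - sig_net m a w b x\<bar> < e / 2"
    using sig_net_approx_exp_sum[OF g(1) compact_imp_bounded[OF assms(1)], of "e / 2"] assms(3) by auto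
  have "\<bar>h x - sig_net m a w b x\<bar> < e" if "x \<in> X" for x
    using g(2) n that by (smt (verit) field_sum_of_halves)
  then show ?thesis by blast
qed

lemma sig_net_measurable [measurable]: "sig_net m a w b \<in> borel_measurable borel"
  unfolding sig_net_def sigmoid_def by measurable

section \<open>Joint measurability of local Lipschitz constants\<close>

text \<open>Caratheodory functions are jointly measurable: \<open>x\<close> is replaced by a point
  of a countable dense set within 1 / (n + 1) of it, and continuity in \<open>x\<close> carries the
  limit.\<close>

lemma borel_measurable_pair_if_continuous:
  fixes X :: "'a::euclidean_space set" and g :: "'w \<Rightarrow> 'a \<Rightarrow> 'b::metric_space"
  assumes meas: "\<And>x. x \<in> X \<Longrightarrow> (\<lambda>s. g s x) \<in> borel_measurable M"
    and cont: "\<And>s. s \<in> space M \<Longrightarrow> continuous_on X (g s)"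
  shows "(\<lambda>(s, x). g s x) \<in> borel_measurable (M \<Otimes>\<^sub>M restrict_space borel X)"
proof (cases "X = {}")
  case True
  then have "space (M \<Otimes>\<^sub>M restrict_space borel X) = {}"
    by (simp add: space_pair_measure space_restrict_space)
  then show ?thesis
    by (simp add: measurable_def sets.empty_sets)
next
  case False
  obtain D where D: "countable D" "D \<subseteq> X" "X \<subseteq> closure D"
    using separable by blast
  then have "D \<noteq> {}" using False by auto
  define d where "d = from_nat_into D"
  have dX: "d i \<in> X" for i
    using D \<open>D \<noteq> {}\<close> from_nat_into unfolding d_def by blast
  have near: "\<exists>i. dist (d i) x < e" if "x \<in> X" "0 < e" for x e
    using that D \<open>D \<noteq> {}\<close> by (metis closure_approachable d_def from_nat_into_surj subsetD)
  \<comment> \<open>Taking the least admissible index makes the choice a measurable function of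
    \<open>x\<close> with countably many values.\<close>
  define i where "i n x = (LEAST i. dist (d i) x < 1 / real (Suc n))" for n x
  have i: "dist (d (i n x)) x < 1 / real (Suc n)" if "x \<in> X" for n x
    unfolding i_def using near[OF that, of "1 / real (Suc n)"] by (auto intro: LeastI_ex)
  have [measurable]: "(\<lambda>x. x) \<in> restrict_space borel X \<rightarrow>\<^sub>M borel"
    by (rule measurable_restrict_space1) simp
  have [measurable]: "i n \<in> restrict_space borel X \<rightarrow>\<^sub>M count_space UNIV" for n
    unfolding i_def by measurable
  show ?thesis
  proof (rule borel_measurable_LIMSEQ_metric)
    fix n
    show "(\<lambda>(s, x). g s (d (i n x))) \<in> borel_measurable (M \<Otimes>\<^sub>M restrict_space borel X)"
      unfolding split_beta'
    proof (rule measurable_compose_countable[where f = "\<lambda>j p. g (fst p) (d j)"])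
      show "(\<lambda>p. g (fst p) (d j)) \<in> borel_measurable (M \<Otimes>\<^sub>M restrict_space borel X)" for j
        using meas[OF dX] by (rule measurable_compose[OF measurable_fst])
    qed measurable
  next
    fix p assume "p \<in> space (M \<Otimes>\<^sub>M restrict_space borel X)"
    then obtain s x where p: "p = (s, x)" "s \<in> space M" "x \<in> X"
      by (auto simp: space_pair_measure space_restrict_space)
    have "(\<lambda>n. dist (d (i n x)) x) \<longlonglongrightarrow> 0"
    proof (rule tendsto_sandwich[OF _ _ tendsto_const LIMSEQ_Suc[OF lim_1_over_n]])
      show "eventually (\<lambda>n. dist (d (i n x)) x \<le> 1 / real (Suc n)) sequentially"
        using i[OF p(3)] by (intro always_eventually allI less_imp_le)
    qed simp
    then have "(\<lambda>n. d (i n x)) \<longlonglongrightarrow> x"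
      by (rule iffD2[OF tendsto_dist_iff])
    then have "(\<lambda>n. g s (d (i n x))) \<longlonglongrightarrow> g s x"
      by (rule continuous_on_tendsto_compose[OF cont[OF p(2)] _ p(3)]) (simp add: dX)
    then show "(\<lambda>n. case p of (s, x) \<Rightarrow> g s (d (i n x))) \<longlonglongrightarrow> (case p of (s, x) \<Rightarrow> g s x)"
      by (simp add: p)
  qed
qed

section \<open>Local Lipschitz constants as countable infima and suprema\<close>

lemma loc_lipschitz_on_imp_continuous_on:
  assumes "loc_lipschitz_on X g"
  shows "continuous_on X g"
  unfolding continuous_on_iff
proof (intro ballI allI impI)
  fix x and e :: real assume x: "x \<in> X" and e: "0 < e"
  obtain \<delta> L where \<delta>: "\<delta> > 0"
    "\<forall>y\<in>ball x \<delta> \<inter> X. \<forall>z\<in>ball x \<delta> \<inter> X. norm (g y - g z) \<le> L * dist y z"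
    using assms x unfolding loc_lipschitz_on_def by blast
  show "\<exists>d>0. \<forall>x'\<in>X. dist x' x < d \<longrightarrow> dist (g x') (g x) < e"
  proof (intro exI conjI ballI impI)
    show "0 < min \<delta> (e / (\<bar>L\<bar> + 1))" using \<delta> e by simp
    fix y assume y: "y \<in> X" "dist y x < min \<delta> (e / (\<bar>L\<bar> + 1))"
    have "dist (g y) (g x) \<le> L * dist y x"
      unfolding dist_norm[of "g y"] using \<delta> x y by (intro \<delta>(2)[rule_format]) (auto simp: dist_commute)
    also have "\<dots> \<le> (\<bar>L\<bar> + 1) * dist y x"
      by (intro mult_right_mono) auto
    also have "\<dots> < (\<bar>L\<bar> + 1) * (e / (\<bar>L\<bar> + 1))"
      using y by (intro mult_strict_left_mono) auto
    finally show "dist (g y) (g x) < e" by simp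
  qed
qed

text \<open>The value 0 off the ball and on the diagonal moves the dependence on the centre from the
  index set of the supremum into the function, so that the supremum runs over one fixed countable
  set.\<close>

definition quotient_on :: "'a::metric_space set \<Rightarrow> ('a \<Rightarrow> 'b::real_normed_vector) \<Rightarrow> 'a \<times> 'a \<Rightarrow> ennreal" where
  "quotient_on A g p = (if fst p \<in> A \<and> snd p \<in> A \<and> fst p \<noteq> snd p
     then ennreal (norm (g (fst p) - g (snd p)) / dist (fst p) (snd p)) else 0)"

text \<open>By continuity, the quotient at any pair of points of \<open>X\<close> is a limit of
  quotients at pairs from \<open>D\<close> in the same ball; by monotonicity in the radius, a
  sequence of radii suffices. Only countable operations remain.\<close>

lemma lip_const_dense:
  fixes X :: "'a::euclidean_space set" and g :: "'a \<Rightarrow> 'b::real_normed_vector"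
  assumes cont: "continuous_on X g" and D: "D \<subseteq> X" "X \<subseteq> closure D"
  shows "lip_const X g x = enn2real (INF n. SUP p\<in>D \<times> D. quotient_on (ball x (1 / real (Suc n))) g p)"
proof -
  let ?s = "\<lambda>\<delta>. SUP p\<in>{(y, z). y \<in> ball x \<delta> \<inter> X \<and> z \<in> ball x \<delta> \<inter> X \<and> y \<noteq> z}.
        ennreal (norm (g (fst p) - g (snd p)) / dist (fst p) (snd p))"
  have eq: "?s \<delta> = (SUP p\<in>D \<times> D. quotient_on (ball x \<delta>) g p)" for \<delta>
  proof (rule antisym)
    show "(SUP p\<in>D \<times> D. quotient_on (ball x \<delta>) g p) \<le> ?s \<delta>"
    proof (rule SUP_least)
      fix p assume "p \<in> D \<times> D"
      then show "quotient_on (ball x \<delta>) g p \<le> ?s \<delta>"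
        using D(1) by (auto simp: quotient_on_def intro!: SUP_upper2[of p])
    qed
    show "?s \<delta> \<le> (SUP p\<in>D \<times> D. quotient_on (ball x \<delta>) g p)"
    proof (rule SUP_least)
      fix p assume "p \<in> {(y, z). y \<in> ball x \<delta> \<inter> X \<and> z \<in> ball x \<delta> \<inter> X \<and> y \<noteq> z}"
      then obtain y z where p: "p = (y, z)" "y \<in> ball x \<delta>" "z \<in> ball x \<delta>" "y \<in> X" "z \<in> X" "y \<noteq> z"
        by auto
      obtain Y where Y: "\<And>n. Y n \<in> D" "Y \<longlonglongrightarrow> y"
        using D p(4) by (metis closure_sequential subsetD)
      obtain Z where Z: "\<And>n. Z n \<in> D" "Z \<longlonglongrightarrow> z"
        using D p(5) by (metis closure_sequential subsetD)
      have gY: "(\<lambda>n. g (Y n)) \<longlonglongrightarrow> g y" and gZ: "(\<lambda>n. g (Z n)) \<longlonglongrightarrow> g z"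
        using Y(1) Z(1) D(1)
        by (auto intro!: continuous_on_tendsto_compose[OF cont Y(2) p(4)]
            continuous_on_tendsto_compose[OF cont Z(2) p(5)] always_eventually)
      have lim: "(\<lambda>n. ennreal (norm (g (Y n) - g (Z n)) / dist (Y n) (Z n)))
          \<longlonglongrightarrow> ennreal (norm (g y - g z) / dist y z)"
        using p(6) by (intro tendsto_ennrealI tendsto_intros gY gZ Y Z) auto
      \<comment> \<open>Lying in the open ball and being distinct are open conditions, so the
        approximating pairs eventually satisfy them.\<close>
      have ev: "eventually (\<lambda>n. Y n \<in> ball x \<delta> \<and> Z n \<in> ball x \<delta> \<and> Y n \<noteq> Z n) sequentially"
      proof (intro eventually_conj)
        show "eventually (\<lambda>n. Y n \<in> ball x \<delta>) sequentially"
          by (rule topological_tendstoD[OF Y(2) open_ball p(2)])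
        show "eventually (\<lambda>n. Z n \<in> ball x \<delta>) sequentially"
          by (rule topological_tendstoD[OF Z(2) open_ball p(3)])
        have "eventually (\<lambda>n. dist (Y n) (Z n) > 0) sequentially"
          by (rule order_tendstoD[OF tendsto_dist[OF Y(2) Z(2)]]) (use p(6) in simp)
        then show "eventually (\<lambda>n. Y n \<noteq> Z n) sequentially"
          by eventually_elim simp
      qed
      have "eventually (\<lambda>n. ennreal (norm (g (Y n) - g (Z n)) / dist (Y n) (Z n))
          \<le> (SUP p\<in>D \<times> D. quotient_on (ball x \<delta>) g p)) sequentially"
        using ev
      proof eventually_elim
        case (elim n)
        then show ?case
          using Y(1) Z(1) by (intro SUP_upper2[of "(Y n, Z n)"]) (auto simp: quotient_on_def)
      qed
      then show "ennreal (norm (g (fst p) - g (snd p)) / dist (fst p) (snd p))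
          \<le> (SUP p\<in>D \<times> D. quotient_on (ball x \<delta>) g p)"
        using tendsto_upperbound[OF lim] p(1) by simp
    qed
  qed
  have "(INF \<delta>\<in>{0<..}. ?s \<delta>) = (INF n. ?s (1 / real (Suc n)))"
  proof (rule antisym)
    show "(INF \<delta>\<in>{0<..}. ?s \<delta>) \<le> (INF n. ?s (1 / real (Suc n)))"
      by (intro INF_greatest INF_lower) simp
    show "(INF n. ?s (1 / real (Suc n))) \<le> (INF \<delta>\<in>{0<..}. ?s \<delta>)"
    proof (rule INF_mono)
      fix \<delta> :: real assume "\<delta> \<in> {0<..}"
      then obtain n where "1 / real (Suc n) < \<delta>"
        using nat_approx_posE by auto
      then have "?s (1 / real (Suc n)) \<le> ?s \<delta>"
        by (intro SUP_subset_mono) auto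
      then show "\<exists>n\<in>UNIV. ?s (1 / real (Suc n)) \<le> ?s \<delta>" by blast
    qed
  qed
  then show ?thesis
    unfolding lip_const_def eq by simp
qed

text \<open>The product in the definition of \<open>V_star\<close> evaluates each Lipschitz constant
  at the random current state, which calls for measurability jointly in the map and the
  point.\<close>

lemma lip_const_measurable_pair:
  fixes X :: "'a::euclidean_space set"
    and g :: "'w \<Rightarrow> 'a \<Rightarrow> 'b::{real_normed_vector, second_countable_topology}"
  assumes meas: "\<And>x. x \<in> X \<Longrightarrow> (\<lambda>s. g s x) \<in> borel_measurable M"
    and cont: "\<And>s. s \<in> space M \<Longrightarrow> continuous_on X (g s)"
  shows "(\<lambda>(s, x). lip_const X (g s) x) \<in> borel_measurable (M \<Otimes>\<^sub>M restrict_space borel X)"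
proof -
  obtain D where D: "countable D" "D \<subseteq> X" "X \<subseteq> closure D"
    using separable by blast
  let ?P = "M \<Otimes>\<^sub>M restrict_space borel X"
  have [measurable]: "(\<lambda>x. x) \<in> restrict_space borel X \<rightarrow>\<^sub>M borel"
    by (rule measurable_restrict_space1) simp
  have "(\<lambda>q. quotient_on (ball (snd q) \<delta>) (g (fst q)) p) \<in> borel_measurable ?P" if "p \<in> D \<times> D" for p \<delta>
  proof -
    have [measurable]: "(\<lambda>s. g s (fst p)) \<in> borel_measurable M" "(\<lambda>s. g s (snd p)) \<in> borel_measurable M"
      using that D(2) by (auto intro!: meas)
    have [measurable]: "(\<lambda>q. snd q) \<in> ?P \<rightarrow>\<^sub>M borel"
      by (rule measurable_compose[OF measurable_snd]) measurable
    show ?thesis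
      unfolding quotient_on_def mem_ball by measurable
  qed
  then have "(\<lambda>q. enn2real (INF n. SUP p\<in>D \<times> D. quotient_on (ball (snd q) (1 / real (Suc n))) (g (fst q)) p))
      \<in> borel_measurable ?P"
    using D(1) by (intro borel_measurable_enn2real borel_measurable_INF borel_measurable_SUP) auto
  then show ?thesis
    by (rule iffD1[OF measurable_cong, rotated])
       (auto simp: space_pair_measure lip_const_dense[OF cont D(2,3)])
qed

section \<open>Potentials of weighted Markov chains\<close>

text \<open>The integral of an arbitrary nonnegative function is the supremum over simple functions
  below it, and those are measurable.\<close>

lemma nn_integral_le_if_measurable_minorants:
  assumes "\<And>g. g \<in> borel_measurable M \<Longrightarrow> (\<And>x. g x \<le> h x) \<Longrightarrow> (\<integral>\<^sup>+x. g x \<partial>M) \<le> B"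
  shows "(\<integral>\<^sup>+x. h x \<partial>M) \<le> B"
  unfolding nn_integral_def
proof (safe intro!: SUP_least)
  fix g assume g: "simple_function M g" "g \<le> h"
  then show "integral\<^sup>S M g \<le> B"
    using assms[of g] by (auto simp: nn_integral_eq_simple_integral le_fun_def borel_measurable_simple_function)
qed

text \<open>A measurable \<open>g\<close> below \<open>c + d * h\<close> yields the measurable
  function \<open>(g - c) / d\<close> below \<open>h\<close>; finiteness of \<open>c\<close> and
  \<open>d\<close> permits this rearrangement.\<close>

lemma (in prob_space) nn_integral_affine_le:
  assumes "c < \<top>" "d < \<top>"
  shows "(\<integral>\<^sup>+x. c + d * h x \<partial>M) \<le> c + d * (\<integral>\<^sup>+x. h x \<partial>M)"
proof (rule nn_integral_le_if_measurable_minorants)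
  fix g assume [measurable]: "g \<in> borel_measurable M" and g: "\<And>x. g x \<le> c + d * h x"
  have le: "g x - c \<le> d * h x" for x
    using g[of x] assms(1) by (auto simp: ennreal_minus_le_iff)
  \<comment> \<open>Subtraction in \<open>ennreal\<close> is truncated at 0, so adding
    \<open>c\<close> back gives at least \<open>g\<close>, with equality only where \<open>g\<close>
    is at least \<open>c\<close>.\<close>
  have "(\<integral>\<^sup>+x. g x \<partial>M) \<le> (\<integral>\<^sup>+x. c + (g x - c) \<partial>M)"
    by (intro nn_integral_mono) (metis add.commute ennreal_minus_le_iff order_refl)
  also have "\<dots> = c + (\<integral>\<^sup>+x. g x - c \<partial>M)"
    by (subst nn_integral_add) (auto simp: emeasure_space_1)
  also have "(\<integral>\<^sup>+x. g x - c \<partial>M) \<le> d * (\<integral>\<^sup>+x. h x \<partial>M)"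
  proof (cases "d = 0")
    case True
    then show ?thesis using le by (simp add: zero_ennreal_def[symmetric])
  next
    case False
    have "(\<integral>\<^sup>+x. g x - c \<partial>M) = d * (\<integral>\<^sup>+x. (g x - c) / d \<partial>M)"
      using False assms(2)
      by (subst nn_integral_cmult[symmetric])
         (auto intro!: nn_integral_cong simp: ennreal_times_divide ennreal_mult_divide_eq mult.commute[of d])
    also have "\<dots> \<le> d * (\<integral>\<^sup>+x. h x \<partial>M)"
    proof (intro mult_left_mono nn_integral_mono)
      fix x
      show "(g x - c) / d \<le> h x"
        using le[of x] False assms(2) by (intro divide_le_posI_ennreal) (auto simp: mult.commute zero_less_iff_neq_zero)
    qed simp
    finally show ?thesis .
  qed
  finally show "(\<integral>\<^sup>+x. g x \<partial>M) \<le> c + d * (\<integral>\<^sup>+x. h x \<partial>M)"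
    by (simp add: add_left_mono)
qed

text \<open>Prepending an independent first coordinate leaves the law of an iid sequence unchanged;
  Tonelli then conditions on that coordinate.\<close>

lemma (in sequence_space) nn_integral_S_iter:
  assumes [measurable]: "g \<in> borel_measurable S"
  shows "(\<integral>\<^sup>+w. g w \<partial>S) = (\<integral>\<^sup>+s. \<integral>\<^sup>+w. g (case_nat s w) \<partial>S \<partial>M)"
proof -
  have "(\<integral>\<^sup>+w. g w \<partial>S) = (\<integral>\<^sup>+p. g (case p of (s, w) \<Rightarrow> case_nat s w) \<partial>(M \<Otimes>\<^sub>M S))"
    by (subst PiM_iter[symmetric]) (simp add: nn_integral_distr)
  also have "\<dots> = (\<integral>\<^sup>+s. \<integral>\<^sup>+w. g (case_nat s w) \<partial>S \<partial>M)"
    by (subst P.nn_integral_fst[symmetric]) simp_all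
  finally show ?thesis .
qed

text \<open>Each measurable minorant of \<open>h\<close> satisfies the iterated formula exactly;
  without measurability of \<open>h\<close> this leaves one inequality.\<close>

lemma (in sequence_space) nn_integral_S_iter_le:
  "(\<integral>\<^sup>+w. h w \<partial>S) \<le> (\<integral>\<^sup>+s. \<integral>\<^sup>+w. h (case_nat s w) \<partial>S \<partial>M)"
  by (rule nn_integral_le_if_measurable_minorants)
     (auto simp: nn_integral_S_iter intro!: nn_integral_mono)

lemma chain_case_nat: "chain f (case_nat s w) x (Suc k) = chain f w (f s x) k"
  by (induction k) simp_all

lemma ennreal_suminf_finite_imp_tendsto_0:
  fixes a :: "nat \<Rightarrow> ennreal"
  assumes "(\<Sum>n. a n) < \<top>"
  shows "a \<longlonglongrightarrow> 0"
proof -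
  have fin: "a n < \<top>" for n
    using assms ennreal_suminf_lessD by blast
  then have eq: "a = (\<lambda>n. ennreal (enn2real (a n)))"
    by auto
  then have "summable (\<lambda>n. enn2real (a n))"
    using assms by (intro summable_suminf_not_top) auto
  then have "(\<lambda>n. ennreal (enn2real (a n))) \<longlonglongrightarrow> ennreal 0"
    by (intro tendsto_ennrealI summable_LIMSEQ_zero)
  then show ?thesis
    using eq by simp
qed

section \<open>The transfer operator and its powers in path form\<close>

locale weighted_chain = M0: prob_space M for M :: "'w measure" +
  fixes N :: "'a measure" and f :: "'w \<Rightarrow> 'a \<Rightarrow> 'a" and L :: "'w \<Rightarrow> 'a \<Rightarrow> ennreal"
  assumes f_measurable [measurable]: "(\<lambda>(s, x). f s x) \<in> M \<Otimes>\<^sub>M N \<rightarrow>\<^sub>M N"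
    and L_measurable [measurable]: "(\<lambda>(s, x). L s x) \<in> borel_measurable (M \<Otimes>\<^sub>M N)"
    and L_finite: "s \<in> space M \<Longrightarrow> x \<in> space N \<Longrightarrow> L s x < \<top>"
begin

sublocale sequence_space M
  by unfold_locales

definition weight :: "(nat \<Rightarrow> 'w) \<Rightarrow> 'a \<Rightarrow> nat \<Rightarrow> ennreal" where
  "weight w x k = (\<Prod>l<k. L (w l) (chain f w x l))"

text \<open>The operator \<open>K_op\<close> on extended nonnegative functions, where no
  integrability question arises.\<close>

definition transfer :: "('a \<Rightarrow> ennreal) \<Rightarrow> 'a \<Rightarrow> ennreal" where
  "transfer g x = (\<integral>\<^sup>+s. L s x * g (f s x) \<partial>M)"

text \<open>Path form of the \<open>k\<close>-th power of \<open>transfer\<close> applied to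
  \<open>g\<close>, for measurable \<open>g\<close>.\<close>

definition moment :: "nat \<Rightarrow> ('a \<Rightarrow> ennreal) \<Rightarrow> 'a \<Rightarrow> ennreal" where
  "moment k g x = (\<integral>\<^sup>+w. g (chain f w x k) * weight w x k \<partial>S)"

text \<open>Green potential of \<open>u\<close>. The sum stays under the integral because
  \<open>u\<close> may fail to be measurable.\<close>

definition potential :: "('a \<Rightarrow> ennreal) \<Rightarrow> 'a \<Rightarrow> ennreal" where
  "potential u x = (\<integral>\<^sup>+w. (\<Sum>k. u (chain f w x k) * weight w x k) \<partial>S)"

lemma f_in_space: "s \<in> space M \<Longrightarrow> x \<in> space N \<Longrightarrow> f s x \<in> space N"
  using measurable_space[OF f_measurable, of "(s, x)"] by (simp add: space_pair_measure)

lemma chain_measurable_pair: "(\<lambda>(x, w). chain f w x k) \<in> N \<Otimes>\<^sub>M S \<rightarrow>\<^sub>M N"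
proof (induction k)
  case 0
  then show ?case by simp
next
  case (Suc k)
  note Suc [measurable]
  have "(\<lambda>p. case (snd p k, chain f (snd p) (fst p) k) of (s, x) \<Rightarrow> f s x) \<in> N \<Otimes>\<^sub>M S \<rightarrow>\<^sub>M N"
    using Suc by (intro measurable_compose[OF _ f_measurable] measurable_Pair) (auto simp: split_beta')
  then show ?case by (simp add: split_beta')
qed

lemma weight_measurable_pair: "(\<lambda>(x, w). weight w x k) \<in> borel_measurable (N \<Otimes>\<^sub>M S)"
proof -
  have "(\<lambda>p. case (snd p l, chain f (snd p) (fst p) l) of (s, x) \<Rightarrow> L s x) \<in> borel_measurable (N \<Otimes>\<^sub>M S)" for l
    using chain_measurable_pair[of l]
    by (intro measurable_compose[OF _ L_measurable] measurable_Pair) (auto simp: split_beta')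
  then show ?thesis
    unfolding weight_def split_beta' by (intro borel_measurable_prod_ennreal) simp
qed

lemma chain_in_space: "w \<in> space S \<Longrightarrow> x \<in> space N \<Longrightarrow> chain f w x k \<in> space N"
  using measurable_space[OF chain_measurable_pair[of k], of "(x, w)"] by (simp add: space_pair_measure)

lemma summand_measurable_pair:
  assumes "g \<in> borel_measurable N"
  shows "(\<lambda>(x, w). g (chain f w x k) * weight w x k) \<in> borel_measurable (N \<Otimes>\<^sub>M S)"
  using measurable_compose[OF chain_measurable_pair assms] weight_measurable_pair
  by (auto simp: split_beta' intro!: borel_measurable_times)

lemma summand_measurable:
  assumes "g \<in> borel_measurable N" "x \<in> space N"
  shows "(\<lambda>w. g (chain f w x k) * weight w x k) \<in> borel_measurable S"
  using measurable_compose[OF measurable_Pair1'[OF assms(2)] summand_measurable_pair[OF assms(1)]]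
  by simp

lemma transfer_integrand_measurable:
  assumes "g \<in> borel_measurable N" "x \<in> space N"
  shows "(\<lambda>s. L s x * g (f s x)) \<in> borel_measurable M"
  using measurable_compose[OF measurable_Pair2'[OF assms(2)] L_measurable]
    measurable_compose[OF measurable_Pair2'[OF assms(2)] measurable_compose[OF f_measurable assms(1)]]
  by (auto intro!: borel_measurable_times)

lemma transfer_measurable:
  assumes [measurable]: "g \<in> borel_measurable N"
  shows "transfer g \<in> borel_measurable N"
  unfolding transfer_def
proof (rule M0.borel_measurable_nn_integral)
  have "(\<lambda>p. case (snd p, fst p) of (s, x) \<Rightarrow> L s x * g (f s x)) \<in> borel_measurable (N \<Otimes>\<^sub>M M)"
  proof (rule measurable_compose[of _ _ "M \<Otimes>\<^sub>M N"])
    show "(\<lambda>(s, x). L s x * g (f s x)) \<in> borel_measurable (M \<Otimes>\<^sub>M N)"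
      using L_measurable measurable_compose[OF f_measurable assms]
      by (auto simp: split_beta' intro!: borel_measurable_times)
  qed simp
  then show "(\<lambda>(x, s). L s x * g (f s x)) \<in> borel_measurable (N \<Otimes>\<^sub>M M)"
    by (simp add: split_beta')
qed

lemma transfer_cong: "(\<And>y. y \<in> space N \<Longrightarrow> g y = h y) \<Longrightarrow> x \<in> space N \<Longrightarrow> transfer g x = transfer h x"
  unfolding transfer_def by (intro nn_integral_cong) (simp add: f_in_space)

lemma weight_case_nat: "weight (case_nat s w) x (Suc k) = L s x * weight w (f s x) k"
  unfolding weight_def by (simp add: prod.lessThan_Suc_shift chain_case_nat del: chain.simps(2) prod.lessThan_Suc)

lemma moment_0: "moment 0 g x = g x"
  by (simp add: moment_def weight_def P.emeasure_space_1)

text \<open>Markov property at time 1: given the first map, the remaining path is a fresh chain from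
  \<open>f s x\<close>, and the first weight factors out.\<close>

lemma moment_Suc:
  assumes "g \<in> borel_measurable N" "x \<in> space N"
  shows "moment (Suc k) g x = transfer (moment k g) x"
proof -
  have "moment (Suc k) g x =
      (\<integral>\<^sup>+s. \<integral>\<^sup>+w. L s x * (g (chain f w (f s x) k) * weight w (f s x) k) \<partial>S \<partial>M)"
    unfolding moment_def
    by (subst nn_integral_S_iter[OF summand_measurable[OF assms]])
       (simp add: chain_case_nat weight_case_nat mult_ac del: chain.simps(2))
  also have "\<dots> = (\<integral>\<^sup>+s. L s x * moment k g (f s x) \<partial>M)"
    unfolding moment_def
    by (intro nn_integral_cong nn_integral_cmult summand_measurable assms f_in_space)
  finally show ?thesis
    by (simp add: transfer_def)
qed

text \<open>Conditioning on the first map puts the new operator outside; the induction moves it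
  inside, next to \<open>g\<close>, as telescoping requires.\<close>

lemma moment_transfer:
  assumes "g \<in> borel_measurable N" "x \<in> space N"
  shows "moment k (transfer g) x = moment (Suc k) g x"
  using assms(2)
proof (induction k arbitrary: x)
  case 0
  then show ?case
    using transfer_cong[of "moment 0 g" g x] by (simp add: moment_Suc assms(1) moment_0)
next
  case (Suc k)
  have "moment (Suc k) (transfer g) x = transfer (moment k (transfer g)) x"
    by (intro moment_Suc transfer_measurable assms(1) Suc.prems)
  also have "\<dots> = transfer (moment (Suc k) g) x"
    by (intro transfer_cong Suc.IH Suc.prems)
  also have "\<dots> = moment (Suc (Suc k)) g x"
    by (intro moment_Suc[symmetric] assms(1) Suc.prems)
  finally show ?case .
qed

lemma moment_add:
  assumes "g \<in> borel_measurable N" "h \<in> borel_measurable N" "x \<in> space N"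
  shows "moment k (\<lambda>y. g y + h y) x = moment k g x + moment k h x"
  unfolding moment_def using summand_measurable[OF assms(1,3)] summand_measurable[OF assms(2,3)]
  by (subst nn_integral_add[symmetric]) (simp_all add: distrib_right)

lemma moment_mono:
  assumes "\<And>y. y \<in> space N \<Longrightarrow> g y \<le> h y" "x \<in> space N"
  shows "moment k g x \<le> moment k h x"
  unfolding moment_def by (intro nn_integral_mono mult_right_mono assms chain_in_space) auto

lemma moment_const:
  assumes "x \<in> space N"
  shows "moment k (\<lambda>_. c) x = c * moment k (\<lambda>_. 1) x"
  unfolding moment_def using summand_measurable[of "\<lambda>_. 1" x k] assms
  by (subst nn_integral_cmult[symmetric]) simp_all

section \<open>The fixed point equation for the potential\<close>

lemma nn_integral_suminf_summand:
  assumes "g \<in> borel_measurable N" "x \<in> space N"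
  shows "(\<integral>\<^sup>+w. (\<Sum>k. g (chain f w x (h k)) * weight w x (h k)) \<partial>S) = (\<Sum>k. moment (h k) g x)"
  unfolding moment_def by (intro nn_integral_suminf summand_measurable assms)

lemma suminf_summand_split_head:
  "(\<Sum>k. u (chain f w x k) * weight w x k) = u x + (\<Sum>k. u (chain f w x (Suc k)) * weight w x (Suc k))"
  by (subst suminf_offset[of _ 1]) (auto simp: weight_def)

text \<open>Conditioning on the first map uses two estimates for lower integrals, both pointing in
  this direction. Measurability of the potential makes the final split of the outer integral
  exact.\<close>

lemma potential_le:
  assumes x: "x \<in> space N" and ux: "u x < \<top>" and meas: "potential u \<in> borel_measurable N"
  shows "potential u x \<le> u x + transfer (potential u) x"
proof -
  have "potential u x \<le> (\<integral>\<^sup>+s. \<integral>\<^sup>+w. u x + L s x * (\<Sum>k. u (chain f w (f s x) k) * weight w (f s x) k) \<partial>S \<partial>M)"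
    unfolding potential_def suminf_summand_split_head[of u _ x]
    by (rule order_trans[OF nn_integral_S_iter_le])
       (simp add: chain_case_nat weight_case_nat mult_ac ennreal_suminf_cmult[symmetric] del: chain.simps(2) ennreal_suminf_cmult)
  also have "\<dots> \<le> (\<integral>\<^sup>+s. u x + L s x * potential u (f s x) \<partial>M)"
    unfolding potential_def by (intro nn_integral_mono P.nn_integral_affine_le ux L_finite x)
  also have "\<dots> = u x + transfer (potential u) x"
    unfolding transfer_def using transfer_integrand_measurable[OF meas x]
    by (subst nn_integral_add) (auto simp: M0.emeasure_space_1)
  finally show ?thesis .
qed

text \<open>The bound \<open>c\<close> controls the total mass of the moments of 1 by the potential,
  and \<open>C\<close> dominates the potential; together they make the telescoping remainder
  vanish.\<close>

theorem potential_fixed_point: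
  assumes meas: "potential u \<in> borel_measurable N"
    and u_pos: "0 < c" "\<And>x. x \<in> space N \<Longrightarrow> c \<le> u x" and u_fin: "\<And>x. x \<in> space N \<Longrightarrow> u x < \<top>"
    and C: "C < \<top>" "\<And>x. x \<in> space N \<Longrightarrow> potential u x \<le> C"
    and x: "x \<in> space N"
  shows "potential u x = u x + transfer (potential u) x"
proof (rule antisym)
  let ?W = "potential u"
  show "?W x \<le> u x + transfer ?W x"
    by (rule potential_le[OF x u_fin[OF x] meas])
  \<comment> \<open>Truncated subtraction, so \<open>u0\<close> is a measurable function that lies
    below \<open>u\<close> by \<open>potential_le\<close>.\<close>
  define u0 where "u0 y = ?W y - transfer ?W y" for y
  have u0_meas: "u0 \<in> borel_measurable N"
    unfolding u0_def using meas transfer_measurable[OF meas] by measurable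
  have u0_le: "u0 y \<le> u y" if "y \<in> space N" for y
    using potential_le[OF that u_fin[OF that] meas] C(1) C(2)[OF that]
    by (auto simp: u0_def ennreal_minus_le_iff add.commute)
  have W_le: "?W y \<le> u0 y + transfer ?W y" for y
    unfolding u0_def by (metis add.commute ennreal_minus_le_iff order_refl)
  have step: "moment k ?W x \<le> moment k u0 x + moment (Suc k) ?W x" for k
    using moment_mono[of ?W "\<lambda>y. u0 y + transfer ?W y" x k, OF W_le x] moment_add[OF u0_meas transfer_measurable[OF meas] x, of k]
      moment_transfer[OF meas x, of k] by simp
  \<comment> \<open>The sum starts at time 1: at time 0 the value \<open>u x\<close> is a constant
    and is kept exactly, and only later values of \<open>u\<close> are replaced by
    \<open>u0\<close>.\<close>
  have telescope: "moment 1 ?W x \<le> (\<Sum>k<n. moment (Suc k) u0 x) + moment (Suc n) ?W x" for n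
  proof (induction n)
    case (Suc n)
    from order_trans[OF this add_left_mono[OF step]] show ?case
      by (simp add: add.assoc)
  qed simp
  have "c * (\<Sum>k. moment k (\<lambda>_. 1) x) = (\<integral>\<^sup>+w. (\<Sum>k. c * weight w x k) \<partial>S)"
    using nn_integral_suminf_summand[of "\<lambda>_. c" x "\<lambda>k. k"] moment_const[OF x, of _ c] x by simp
  also have "\<dots> \<le> ?W x"
    unfolding potential_def
    by (intro nn_integral_mono suminf_le mult_right_mono u_pos chain_in_space x) auto
  also have "\<dots> < \<top>"
    using C(2)[OF x] C(1) by simp
  finally have "(\<Sum>k. moment k (\<lambda>_. 1) x) < \<top>"
    using u_pos(1) by (auto simp: ennreal_mult_less_top)
  then have "(\<lambda>n. moment n (\<lambda>_. 1) x) \<longlonglongrightarrow> 0"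
    by (rule ennreal_suminf_finite_imp_tendsto_0)
  then have "(\<lambda>n. C * moment (Suc n) (\<lambda>_. 1) x) \<longlonglongrightarrow> C * 0"
    by (intro ennreal_tendsto_cmult C(1)) (rule LIMSEQ_Suc)
  then have "(\<lambda>n. (\<Sum>k. moment (Suc k) u0 x) + C * moment (Suc n) (\<lambda>_. 1) x) \<longlonglongrightarrow> (\<Sum>k. moment (Suc k) u0 x) + 0"
    by (intro tendsto_add) auto
  moreover have "moment 1 ?W x \<le> (\<Sum>k. moment (Suc k) u0 x) + C * moment (Suc n) (\<lambda>_. 1) x" for n
    using telescope[of n] sum_le_suminf[of "\<lambda>k. moment (Suc k) u0 x" "{..<n}"]
      moment_mono[of ?W "\<lambda>_. C" x "Suc n", OF C(2) x] moment_const[OF x, of "Suc n" C]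
    by (auto intro: order_trans add_mono)
  ultimately have lim: "moment 1 ?W x \<le> (\<Sum>k. moment (Suc k) u0 x)"
    by (intro LIMSEQ_le_const[of _ _ "moment 1 ?W x"]) auto
  have "u x + transfer ?W x = u x + moment 1 ?W x"
    using moment_transfer[OF meas x, of 0] by (simp add: moment_0)
  also have "\<dots> \<le> u x + (\<integral>\<^sup>+w. (\<Sum>k. u0 (chain f w x (Suc k)) * weight w x (Suc k)) \<partial>S)"
    using lim by (simp only: nn_integral_suminf_summand[OF u0_meas x] add_left_mono)
  \<comment> \<open>Additivity is available since one summand is constant in \<open>w\<close> and
    the other involves only the measurable \<open>u0\<close>.\<close>
  also have "\<dots> = (\<integral>\<^sup>+w. u x + (\<Sum>k. u0 (chain f w x (Suc k)) * weight w x (Suc k)) \<partial>S)"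
    using summand_measurable[OF u0_meas x]
    by (subst nn_integral_add) (auto simp: P.emeasure_space_1 simp del: chain.simps)
  also have "\<dots> \<le> ?W x"
    unfolding potential_def suminf_summand_split_head[of u _ x]
    by (intro nn_integral_mono add_left_mono suminf_le mult_right_mono u0_le chain_in_space x) auto
  finally show "u x + transfer ?W x \<le> ?W x" .
qed

end

section \<open>Approximate solutions\<close>

text \<open>Countably many null sets are discarded, so almost every sequence has \<open>g\<close>
  equal to \<open>f\<close> at all its coordinates, and then chains and weights agree path by
  path.\<close>

lemma V_star_eq_potential:
  fixes X :: "'a::euclidean_space set"
  assumes wc: "weighted_chain M (restrict_space borel X) g (\<lambda>s x. ennreal (lip_const X (g s) x))"
    and eq: "AE s in M. g s = f s" and U: "\<And>x. x \<in> X \<Longrightarrow> 0 \<le> U x" and x: "x \<in> X"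
  shows "V_star M X f U x = weighted_chain.potential M g (\<lambda>s x. ennreal (lip_const X (g s) x)) (\<lambda>x. ennreal (U x)) x"
proof -
  interpret weighted_chain M "restrict_space borel X" g "\<lambda>s x. ennreal (lip_const X (g s) x)"
    by (rule wc)
  have ae: "AE w in S. \<forall>l. g (w l) = f (w l)"
    unfolding AE_all_countable by (intro allI AE_PiM_component M0.prob_space_axioms eq) simp
  show ?thesis
    unfolding V_star_def potential_def
  proof (intro nn_integral_cong_AE, use AE_space ae in eventually_elim)
    case (elim w)
    have ch: "chain f w x k = chain g w x k" for k
      by (induction k) (use elim(2) in auto)
    have "chain g w x k \<in> X" for k
      using chain_in_space[OF elim(1), of x k] x by (simp add: space_restrict_space)
    then show ?case
      unfolding weight_def using U elim(2)
      by (simp add: ch ennreal_mult lip_const_def prod_ennreal prod_nonneg)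
  qed
qed

theorem theorem2:
  fixes M :: "'w measure" and X :: "(real ^ 'd) set"
    and f :: "'w \<Rightarrow> real ^ 'd \<Rightarrow> real ^ 'd" and U :: "real ^ 'd \<Rightarrow> real" and \<epsilon> :: real
  assumes "prob_space M"
    and "compact X"
    and "\<forall>\<omega>\<in>space M. \<forall>x\<in>X. f \<omega> x \<in> X"
    and "\<forall>x\<in>X. (\<lambda>\<omega>. f \<omega> x) \<in> borel_measurable M"
    and "\<forall>x\<in>X. (\<lambda>\<omega>. lip_const X (f \<omega>) x) \<in> borel_measurable M"
    and "AE \<omega> in M. loc_lipschitz_on X (f \<omega>)"
    and "\<forall>x\<in>X. U x \<ge> 0"
    and "(INF x\<in>X. U x) > 0"
    and "(SUP x\<in>X. \<integral>\<^sup>+ \<omega>. ennreal (lip_const X (f \<omega>) x) \<partial>M) < \<infinity>"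
    and "\<forall>x\<in>X. V_star M X f U x < \<infinity>"
    and "continuous_on X (\<lambda>x. enn2real (V_star M X f U x))"
    and "\<epsilon> > 0"
  shows "\<exists>m a w b. (SUP x\<in>X. ennreal \<bar>K_op M X f (sig_net m a w b) x - sig_net m a w b x + U x\<bar>)
                     < ennreal \<epsilon>"
proof -
  define N where "N = restrict_space borel X"
  have space_N [simp]: "space N = X"
    by (simp add: N_def space_restrict_space)
  obtain Z where Z: "Z \<in> null_sets M" "\<And>s. s \<in> space M - Z \<Longrightarrow> loc_lipschitz_on X (f s)"
    using AE_E3[OF assms(6)] by blast
  \<comment> \<open>On the exceptional null set the identity is substituted: it is continuous and
    maps \<open>X\<close> into itself, so joint measurability holds on all of
    \<open>M\<close>.\<close>
  define g where "g s = (if s \<in> Z then (\<lambda>x. x) else f s)" for s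
  have g_AE: "AE s in M. g s = f s"
    using AE_not_in[OF Z(1)] by eventually_elim (simp add: g_def)
  have g_cont: "continuous_on X (g s)" if "s \<in> space M" for s
    using Z(2)[of s] that by (auto simp: g_def intro: loc_lipschitz_on_imp_continuous_on)
  have g_meas: "(\<lambda>s. g s x) \<in> borel_measurable M" if "x \<in> X" for x
  proof -
    have [measurable]: "Z \<in> sets M" "(\<lambda>s. f s x) \<in> borel_measurable M"
      using Z(1) assms(4) that by auto
    have "(\<lambda>s. if s \<in> Z then x else f s x) \<in> borel_measurable M"
      by measurable
    then show ?thesis
      by (simp add: g_def if_distrib[of "\<lambda>h. h x"] cong: if_cong)
  qed
  define L where "L = (\<lambda>s x. ennreal (lip_const X (g s) x))"
  have wc: "weighted_chain M N g L"
  proof (intro weighted_chain.intro weighted_chain_axioms.intro assms(1))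
    have "(\<lambda>(s, x). g s x) \<in> M \<Otimes>\<^sub>M N \<rightarrow>\<^sub>M borel"
      unfolding N_def by (rule borel_measurable_pair_if_continuous[OF g_meas g_cont])
    then show "(\<lambda>(s, x). g s x) \<in> M \<Otimes>\<^sub>M N \<rightarrow>\<^sub>M N"
      using assms(3) unfolding N_def
      by (intro measurable_restrict_space2) (auto simp: g_def space_pair_measure space_restrict_space)
    show "(\<lambda>(s, x). L s x) \<in> borel_measurable (M \<Otimes>\<^sub>M N)"
      using lip_const_measurable_pair[OF g_meas g_cont]
      unfolding N_def L_def split_beta' by (rule measurable_compose[OF _ measurable_ennreal])
  qed (simp add: L_def)
  interpret weighted_chain M N g L
    by (rule wc)
  define W where "W x = enn2real (V_star M X f U x)" for x
  have W_cont: "continuous_on X W"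
    unfolding W_def by (rule assms(11))
  have W_meas: "W \<in> borel_measurable N"
    unfolding N_def by (rule borel_measurable_continuous_on_restrict[OF W_cont])
  have W_nonneg: "0 \<le> W x" for x
    by (simp add: W_def)
  have pot: "potential (\<lambda>x. ennreal (U x)) x = ennreal (W x)" if "x \<in> X" for x
    using V_star_eq_potential[OF wc[unfolded N_def L_def] g_AE, of U x] assms(7,10) that
    by (auto simp: W_def L_def)
  \<comment> \<open>A continuous function on a compact set is bounded; this is the uniform bound on
    the potential.\<close>
  obtain C where C: "\<And>x. x \<in> X \<Longrightarrow> W x \<le> C"
    using compact_imp_bounded[OF compact_continuous_image[OF W_cont assms(2)]]
    by (auto simp: bounded_iff abs_le_iff)
  have U_lower: "(INF x\<in>X. U x) \<le> U x" if "x \<in> X" for x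
    using assms(7) that by (intro cINF_lower) (auto intro!: bdd_belowI[of _ 0])
  have fixed_point: "ennreal (W x) = ennreal (U x) + transfer (\<lambda>y. ennreal (W y)) x" if "x \<in> X" for x
  proof -
    have "potential (\<lambda>x. ennreal (U x)) x
        = ennreal (U x) + transfer (potential (\<lambda>x. ennreal (U x))) x"
    proof (rule potential_fixed_point)
      have "(\<lambda>x. ennreal (W x)) \<in> borel_measurable N"
        using W_meas by measurable
      then show "potential (\<lambda>x. ennreal (U x)) \<in> borel_measurable N"
        by (rule iffD1[OF measurable_cong, rotated]) (simp add: pot)
      show "0 < ennreal (INF x\<in>X. U x)"
        using assms(8) by simp
      show "ennreal C < \<top>"
        by simp
    qed (use that U_lower C pot in \<open>auto intro!: ennreal_leI\<close>)
    also have "transfer (potential (\<lambda>x. ennreal (U x))) x = transfer (\<lambda>y. ennreal (W y)) x"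
      using that by (intro transfer_cong) (simp_all add: pot)
    finally show ?thesis
      by (simp add: pot that)
  qed
  define B where "B = enn2real (SUP x\<in>X. \<integral>\<^sup>+ \<omega>. ennreal (lip_const X (f \<omega>) x) \<partial>M)"
  have B_nonneg: "0 \<le> B"
    by (simp add: B_def)
  have lip_nonneg: "0 \<le> lip_const X (f s) x" for s x
    by (simp add: lip_const_def)
  have lip_le: "(\<integral>\<^sup>+ \<omega>. ennreal (lip_const X (f \<omega>) x) \<partial>M) \<le> ennreal B" if "x \<in> X" for x
    using assms(9) that by (auto simp: B_def intro: SUP_upper)
  have lip_int: "integrable M (\<lambda>\<omega>. lip_const X (f \<omega>) x)" if "x \<in> X" for x
    using lip_le[OF that] assms(5) that lip_nonneg
    by (intro integrableI_nonneg) (auto intro: le_less_trans)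
  have lip_int_le: "(\<integral>\<omega>. lip_const X (f \<omega>) x \<partial>M) \<le> B" if "x \<in> X" for x
    using nn_integral_eq_integral[OF lip_int[OF that]] lip_le[OF that] lip_nonneg B_nonneg by simp
  have int: "integrable M (\<lambda>\<omega>. lip_const X (f \<omega>) x * h (f \<omega> x))"
    if x: "x \<in> X" and h: "h \<in> borel_measurable N" "\<And>y. y \<in> X \<Longrightarrow> \<bar>h y\<bar> \<le> c" for x c and h :: "real ^ 'd \<Rightarrow> real"
  proof (rule Bochner_Integration.integrable_bound)
    show "integrable M (\<lambda>\<omega>. lip_const X (f \<omega>) x * c)"
      using lip_int[OF x] by simp
    have "(\<lambda>\<omega>. f \<omega> x) \<in> M \<rightarrow>\<^sub>M N"
      unfolding N_def using assms(3,4) x by (intro measurable_restrict_space2) auto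
    then show "(\<lambda>\<omega>. lip_const X (f \<omega>) x * h (f \<omega> x)) \<in> borel_measurable M"
      using assms(5) x by (intro borel_measurable_times measurable_compose[OF _ h(1)]) auto
    show "AE \<omega> in M. norm (lip_const X (f \<omega>) x * h (f \<omega> x)) \<le> norm (lip_const X (f \<omega>) x * c)"
      using assms(3) x h(2) lip_nonneg
      by (intro AE_I2) (auto simp: abs_mult intro!: mult_left_mono order_trans[OF h(2) abs_ge_self])
  qed
  have W_bound: "\<bar>W x\<bar> \<le> C" if "x \<in> X" for x
    using C[OF that] W_nonneg[of x] by simp
  have fixed_point_real: "W x = U x + K_op M X f W x" if "x \<in> X" for x
  proof -
    \<comment> \<open>Passes from the modified maps \<open>g\<close> back to \<open>f\<close>, which
      agree with them almost surely.\<close>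
    have "transfer (\<lambda>y. ennreal (W y)) x = (\<integral>\<^sup>+\<omega>. ennreal (lip_const X (f \<omega>) x * W (f \<omega> x)) \<partial>M)"
      unfolding transfer_def unfolding L_def
      by (intro nn_integral_cong_AE, use g_AE in eventually_elim) (simp add: ennreal_mult lip_nonneg W_nonneg)
    also have "\<dots> = ennreal (K_op M X f W x)"
      unfolding K_op_def
      by (intro nn_integral_eq_integral int[OF that W_meas W_bound]) (auto simp: lip_nonneg W_nonneg)
    finally have "ennreal (W x) = ennreal (U x + K_op M X f W x)"
      using fixed_point[OF that] assms(7) that
      by (simp add: ennreal_plus K_op_def lip_nonneg W_nonneg integral_nonneg_AE)
    moreover have "0 \<le> U x + K_op M X f W x"
      using assms(7) that by (auto simp: K_op_def lip_nonneg W_nonneg intro!: add_nonneg_nonneg integral_nonneg_AE)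
    ultimately show ?thesis
      using W_nonneg by simp
  qed
  \<comment> \<open>Chosen so that the total error \<delta> (B + 1) is \<epsilon> / 2; the spare
    half keeps the inequality strict after the supremum is taken.\<close>
  define \<delta> where "\<delta> = \<epsilon> / 2 / (B + 1)"
  have "\<delta> * (B + 1) = \<epsilon> / 2"
    using B_nonneg nonzero_eq_divide_eq[of "B + 1" \<delta> "\<epsilon> / 2"] by (simp add: \<delta>_def)
  then have \<delta>: "0 < \<delta>" "\<delta> * B + \<delta> = \<epsilon> / 2"
    using assms(12) B_nonneg by (simp_all add: \<delta>_def distrib_left)
  obtain m a w b where V: "\<forall>x\<in>X. \<bar>W x - sig_net m a w b x\<bar> < \<delta>"
    using sig_net_universal_approximation[OF assms(2) W_cont \<delta>(1)] by blast
  define V where "V = sig_net m a w b"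
  have V_meas: "V \<in> borel_measurable N"
    unfolding V_def N_def by (rule measurable_restrict_space1) measurable
  have V_near: "\<bar>V x - W x\<bar> \<le> \<delta>" if "x \<in> X" for x
    using V that unfolding V_def by (simp add: abs_minus_commute less_imp_le)
  have V_bound: "\<bar>V x\<bar> \<le> C + \<delta>" if "x \<in> X" for x
    using V_near[OF that] W_bound[OF that] by linarith
  have "\<bar>K_op M X f V x - V x + U x\<bar> \<le> \<epsilon> / 2" if x: "x \<in> X" for x
  proof -
    have "\<bar>K_op M X f V x - K_op M X f W x\<bar>
        = norm (\<integral>\<omega>. lip_const X (f \<omega>) x * (V (f \<omega> x) - W (f \<omega> x)) \<partial>M)"
      unfolding K_op_def right_diff_distrib
      using int[OF x V_meas V_bound] int[OF x W_meas W_bound] by (subst Bochner_Integration.integral_diff) auto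
    also have "\<dots> \<le> (\<integral>\<omega>. lip_const X (f \<omega>) x * \<delta> \<partial>M)"
    proof (rule order_trans[OF integral_norm_bound integral_mono])
      show "integrable M (\<lambda>\<omega>. norm (lip_const X (f \<omega>) x * (V (f \<omega> x) - W (f \<omega> x))))"
        using V_meas W_meas V_near by (intro integrable_norm int[OF x, of "\<lambda>y. V y - W y"]) auto
      show "integrable M (\<lambda>\<omega>. lip_const X (f \<omega>) x * \<delta>)"
        using lip_int[OF x] by simp
      show "norm (lip_const X (f \<omega>) x * (V (f \<omega> x) - W (f \<omega> x))) \<le> lip_const X (f \<omega>) x * \<delta>"
        if "\<omega> \<in> space M" for \<omega>
        using that assms(3) x V_near by (auto simp: abs_mult lip_nonneg intro!: mult_left_mono)
    qed
    also have "\<dots> \<le> \<delta> * B"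
      using lip_int_le[OF x] \<delta>(1) by (simp add: mult.commute)
    finally have "\<bar>K_op M X f V x - K_op M X f W x\<bar> \<le> \<delta> * B" .
    \<comment> \<open>Since W = U + K W, the residual of \<open>V\<close> equals (K V - K W) - (V -
      W), whose two terms are bounded by \<delta> B and \<delta>.\<close>
    then show ?thesis
      using fixed_point_real[OF x] V_near[OF x] \<delta>(2) by linarith
  qed
  then have "(SUP x\<in>X. ennreal \<bar>K_op M X f V x - V x + U x\<bar>) \<le> ennreal (\<epsilon> / 2)"
    by (intro SUP_least ennreal_leI)
  also have "\<dots> < ennreal \<epsilon>"
    using assms(12) by (simp add: ennreal_less_iff)
  finally show ?thesis
    unfolding V_def by blast
qed

end
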